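(* Suppose $a,q\in\mathbb{N}$ with $q\geq a\geq 2$. Then \[ \chi_{sc}(K_{a,q})\leq 2q+a\left\lceil\sqrt{32q(1+\log a)}\right\rceil, \] where $\log$ is the natural logarithm.
   Context: $K_{a,q}$ is the complete bipartite graph with parts of sizes $a$ and $q$. For a graph $G=(V,E)$ and $f:V\to\mathbb{N}$, an $f$-assignment is an assignment of color lists $L(v)$ with $|L(v)|=f(v)$; $G$ is $f$-choosable if for every $f$-assignment $L$ there is a proper coloring $c$ with $c(v)\in L(v)$ for all $v$. The sum choice number $\chi_{sc}(G)$ is the minimum of $\sum_{v\in V}f(v)$ over all $f$ such that $G$ is $f$-choosable. *)

theory Defs
  imports Complex_Main "Graph_Theory.Kuratowski"
begin

text \<open>
  Undirected graphs are the symmetric digraphs of the locale \<^locale>\<open>graph\<close>; an edge between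
  \<open>u\<close> and \<open>v\<close> is represented by the two pairs \<open>(u, v)\<close> and \<open>(v, u)\<close> in \<^term>\<open>arcs_ends G\<close>.
\<close>

definition proper_coloring :: "('a, 'b) pre_digraph \<Rightarrow> ('a \<Rightarrow> 'c) \<Rightarrow> bool" where
  "proper_coloring G c \<longleftrightarrow> (\<forall>(u, v) \<in> arcs_ends G. c u \<noteq> c v)"

text \<open>
  Finiteness of the lists is explicit because \<^const>\<open>card\<close> is \<open>0\<close> on infinite sets.
\<close>
definition list_assignment ::
    "('a, 'b) pre_digraph \<Rightarrow> ('a \<Rightarrow> nat) \<Rightarrow> ('a \<Rightarrow> 'c set) \<Rightarrow> bool" where
  "list_assignment G f L \<longleftrightarrow> (\<forall>v \<in> verts G. finite (L v) \<and> card (L v) = f v)"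

text \<open>
  Colours are natural numbers. For a finite graph this is no restriction: see
  \<open>choosable_any_colors\<close> below.
\<close>
definition choosable :: "('a, 'b) pre_digraph \<Rightarrow> ('a \<Rightarrow> nat) \<Rightarrow> bool" where
  "choosable G f \<longleftrightarrow>
    (\<forall>L :: 'a \<Rightarrow> nat set. list_assignment G f L \<longrightarrow>
      (\<exists>c. proper_coloring G c \<and> (\<forall>v \<in> verts G. c v \<in> L v)))"

definition sum_choice_number :: "('a, 'b) pre_digraph \<Rightarrow> nat" where
  "sum_choice_number G = (LEAST n. \<exists>f. choosable G f \<and> n = (\<Sum>v \<in> verts G. f v))"

lemma choosable_any_colors:
  fixes L :: "'a \<Rightarrow> 'c set"
  assumes G: "fin_digraph G" and "choosable G f" and L: "list_assignment G f L"
  shows "\<exists>c. proper_coloring G c \<and> (\<forall>v \<in> verts G. c v \<in> L v)"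
proof -
  interpret fin_digraph G by fact
  define U where "U = (\<Union>v \<in> verts G. L v)"
  have "finite U"
    using L by (auto simp: U_def list_assignment_def)
  then obtain h :: "'c \<Rightarrow> nat" where h: "inj_on h U"
    using finite_imp_inj_to_nat_seg by blast
  have sub: "L v \<subseteq> U" if "v \<in> verts G" for v
    using that by (auto simp: U_def)
  have "list_assignment G f (\<lambda>v. h ` L v)"
    using L inj_on_subset[OF h sub] by (auto simp: list_assignment_def card_image)
  then obtain c where c: "proper_coloring G c" "\<forall>v \<in> verts G. c v \<in> h ` L v"
    using assms(2) by (auto simp: choosable_def)
  have hc: "inv_into U h (c v) \<in> L v \<and> h (inv_into U h (c v)) = c v" if v: "v \<in> verts G" for v
  proof -
    obtain x where x: "x \<in> L v" "c v = h x" using c(2) v by blast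
    moreover have "x \<in> U" using x sub[OF v] by blast
    ultimately show ?thesis using h by simp
  qed
  have "proper_coloring G (\<lambda>v. inv_into U h (c v))"
    unfolding proper_coloring_def
  proof clarify
    fix u v
    assume uv: "u \<rightarrow>\<^bsub>G\<^esub> v" and eq: "inv_into U h (c u) = inv_into U h (c v)"
    have "c u = c v" using eq hc adj_in_verts[OF uv] by metis
    then show False using c(1) uv by (auto simp: proper_coloring_def)
  qed
  then show ?thesis using hc by blast
qed

lemma choosable_card_verts:
  assumes "fin_digraph G" and "loopfree_digraph G"
  shows "choosable G (\<lambda>_. card (verts G))"
  unfolding choosable_def
proof (intro allI impI)
  interpret fin_digraph G by fact
  interpret loopfree_digraph G by fact
  fix L :: "'a \<Rightarrow> nat set"
  assume L: "list_assignment G (\<lambda>_. card (verts G)) L"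
  have "\<exists>c. inj_on c W \<and> (\<forall>v \<in> W. c v \<in> L v)" if "finite W" "W \<subseteq> verts G" for W
    using that
  proof (induction W rule: finite_induct)
    case empty
    then show ?case by simp
  next
    case (insert w W)
    then obtain c where c: "inj_on c W" "\<forall>v \<in> W. c v \<in> L v" by auto
    have "card (c ` W) \<le> card W"
      using insert.hyps by (simp add: card_image_le)
    also have "card W < card (insert w W)"
      using insert.hyps by simp
    also have "card (insert w W) \<le> card (verts G)"
      using insert.prems by (intro card_mono) auto
    also have "card (verts G) = card (L w)"
      using L insert.prems by (simp add: list_assignment_def)
    finally have "\<not> L w \<subseteq> c ` W"
      using insert.hyps by (meson card_mono finite_imageI not_le)
    then obtain x where x: "x \<in> L w" "x \<notin> c ` W" by blast
    have "inj_on (c(w := x)) (insert w W)"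
      using c(1) x(2) insert.hyps by (auto simp: inj_on_def)
    moreover have "\<forall>v \<in> insert w W. (c(w := x)) v \<in> L v"
      using c(2) x(1) by auto
    ultimately show ?case by blast
  qed
  then obtain c where c: "inj_on c (verts G)" "\<forall>v \<in> verts G. c v \<in> L v"
    using finite_verts by blast
  have "proper_coloring G c"
    unfolding proper_coloring_def
  proof clarify
    fix u v
    assume uv: "u \<rightarrow>\<^bsub>G\<^esub> v" and "c u = c v"
    then have "u = v" using c(1) adj_in_verts[OF uv] by (auto dest: inj_onD)
    then show False using uv adj_not_same by blast
  qed
  then show "\<exists>c. proper_coloring G c \<and> (\<forall>v \<in> verts G. c v \<in> L v)"
    using c(2) by blast
qed

lemma sum_choice_number_attained:
  assumes "fin_digraph G" and "loopfree_digraph G"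
  shows "\<exists>f. choosable G f \<and> sum_choice_number G = (\<Sum>v \<in> verts G. f v)"
  unfolding sum_choice_number_def
  by (rule LeastI_ex) (use choosable_card_verts[OF assms] in blast)

lemma sum_choice_number_le:
  assumes "choosable G f"
  shows "sum_choice_number G \<le> (\<Sum>v \<in> verts G. f v)"
  unfolding sum_choice_number_def by (rule Least_le) (use assms in blast)

end

theory Submission
  imports Defs
begin

text \<open>
  Give lists of size \<open>2\<close> to the part \<open>Q\<close> of size \<open>q\<close> and lists of size
  \<open>s = \<lceil>sqrt (32 q (1 + ln a))\<rceil>\<close> to the part \<open>A\<close> of size \<open>a\<close>. Select every colour independently
  with probability \<open>p = s / (8 q)\<close>, and let \<open>S\<close> be the set of selected colours. The expected number
  of lists of \<open>Q\<close> contained in \<open>S\<close> is \<open>p\<^sup>2 q = s\<^sup>2 / (64 q)\<close>, while \<open>S\<close> meets a list of \<open>A\<close> in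
  \<open>p s = s\<^sup>2 / (8 q) \<ge> 4 (1 + ln a)\<close> colours on average. By Markov's inequality and an exponential
  moment bound, with positive probability the intersection of \<open>S\<close> with every list of \<open>A\<close> has more
  elements than there are lists of \<open>Q\<close> contained in \<open>S\<close>. Removing one colour of each such list from
  \<open>S\<close> then leaves a set of colours which meets every list of \<open>A\<close> and contains no list of \<open>Q\<close>.
\<close>

text \<open>Expand the product over \<open>V\<close> of the factors \<open>p * z + (1 - p)\<close>
  on \<open>L\<close> and \<open>p + (1 - p)\<close> off \<open>L\<close>; the set \<open>S\<close>
  records the factors that contribute their first summand. For a probability \<open>p\<close> this
  is the generating function of a binomial variable, and \<open>z = 1\<close> gives total weight
  1.\<close>

lemma sum_Pow_bernoulli_power_card_Int:
  fixes p z :: "'b :: comm_ring_1"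
  assumes "finite V" and "L \<subseteq> V"
  shows "(\<Sum>S\<in>Pow V. p ^ card S * (1 - p) ^ card (V - S) * z ^ card (S \<inter> L))
    = (1 - p + p * z) ^ card L"
proof -
  have "(\<Sum>S\<in>Pow V. p ^ card S * (1 - p) ^ card (V - S) * z ^ card (S \<inter> L))
      = (\<Sum>S\<in>Pow V. (\<Prod>x\<in>S. p * (if x \<in> L then z else 1)) * (\<Prod>x\<in>V - S. 1 - p))"
  proof (rule sum.cong[OF refl])
    fix S assume "S \<in> Pow V"
    then have "finite S" using assms(1) finite_subset by auto
    then have "(\<Prod>x\<in>S. if x \<in> L then z else 1) = z ^ card (S \<inter> L)"
      by (simp flip: prod.inter_restrict)
    then show "p ^ card S * (1 - p) ^ card (V - S) * z ^ card (S \<inter> L)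
        = (\<Prod>x\<in>S. p * (if x \<in> L then z else 1)) * (\<Prod>x\<in>V - S. 1 - p)"
      by (simp add: prod.distrib mult_ac)
  qed
  also have "\<dots> = (\<Prod>x\<in>V. p * (if x \<in> L then z else 1) + (1 - p))"
    by (rule prod_add[OF assms(1), symmetric])
  also have "\<dots> = (\<Prod>x\<in>V. if x \<in> L then 1 - p + p * z else 1)"
    by (rule prod.cong) auto
  also have "\<dots> = (1 - p + p * z) ^ card (V \<inter> L)"
    using assms(1) by (simp flip: prod.inter_restrict)
  also have "V \<inter> L = L" using assms(2) by auto
  finally show ?thesis .
qed

text \<open>The same expansion, with the second summand replaced by 0 on \<open>E\<close>, so that
  every \<open>S\<close> missing a point of \<open>E\<close> contributes nothing.\<close>

lemma sum_Pow_bernoulli_superset: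
  fixes p :: "'b :: comm_ring_1"
  assumes "finite V" and "E \<subseteq> V"
  shows "(\<Sum>S\<in>Pow V. p ^ card S * (1 - p) ^ card (V - S) * of_bool (E \<subseteq> S)) = p ^ card E"
proof -
  have "(\<Sum>S\<in>Pow V. p ^ card S * (1 - p) ^ card (V - S) * of_bool (E \<subseteq> S))
      = (\<Sum>S\<in>Pow V. (\<Prod>x\<in>S. p) * (\<Prod>x\<in>V - S. if x \<in> E then 0 else 1 - p))"
  proof (rule sum.cong[OF refl])
    fix S assume "S \<in> Pow V"
    show "p ^ card S * (1 - p) ^ card (V - S) * of_bool (E \<subseteq> S)
        = (\<Prod>x\<in>S. p) * (\<Prod>x\<in>V - S. if x \<in> E then 0 else 1 - p)"
    proof (cases "E \<subseteq> S")
      case True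
      then have "(\<Prod>x\<in>V - S. if x \<in> E then 0 else 1 - p) = (\<Prod>x\<in>V - S. 1 - p)"
        by (intro prod.cong) auto
      with True show ?thesis by simp
    next
      case False
      then have "(\<Prod>x\<in>V - S. if x \<in> E then 0 else 1 - p) = 0"
        using assms by (intro prod_zero) auto
      with False show ?thesis by simp
    qed
  qed
  also have "\<dots> = (\<Prod>x\<in>V. p + (if x \<in> E then 0 else 1 - p))"
    by (rule prod_add[OF assms(1), symmetric])
  also have "\<dots> = (\<Prod>x\<in>V. if x \<in> E then p else 1)"
    by (rule prod.cong) auto
  also have "\<dots> = p ^ card (V \<inter> E)"
    using assms(1) by (simp flip: prod.inter_restrict)
  also have "V \<inter> E = E" using assms(2) by auto
  finally show ?thesis .
qed

lemma exists_less_1_of_weighted_sum_less_1: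
  fixes w F :: "'a \<Rightarrow> real"
  assumes "\<And>x. x \<in> X \<Longrightarrow> 0 \<le> w x" and "sum w X = 1" and "(\<Sum>x\<in>X. w x * F x) < 1"
  shows "\<exists>x\<in>X. F x < 1"
proof (rule ccontr)
  assume "\<not> ?thesis"
  then have "w x \<le> w x * F x" if "x \<in> X" for x
    using mult_left_mono[of 1 "F x" "w x"] assms(1) that by fastforce
  then have "(\<Sum>x\<in>X. w x) \<le> (\<Sum>x\<in>X. w x * F x)" by (rule sum_mono)
  with assms(2,3) show False by simp
qed

lemma exists_set_few_pairs_large_intersections:
  fixes L :: "'v \<Rightarrow> 'c set" and s :: nat
  assumes A: "finite A" "A \<noteq> {}" "\<And>u. u \<in> A \<Longrightarrow> finite (L u) \<and> card (L u) = s"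
    and Q: "finite Q" "Q \<noteq> {}" "\<And>v. v \<in> Q \<Longrightarrow> finite (L v) \<and> card (L v) = 2"
    and s_le: "s \<le> 8 * card Q"
    and s_ge: "32 * real (card Q) * (1 + ln (real (card A))) \<le> (real s)\<^sup>2"
  shows "\<exists>S. \<forall>u\<in>A. card {v\<in>Q. L v \<subseteq> S} < card (S \<inter> L u)"
proof -
  define a where "a = real (card A)"
  define q where "q = real (card Q)"
  define V where "V = (\<Union>v\<in>A \<union> Q. L v)"
  define p where "p = real s / (8 * q)"
  \<comment> \<open>The threshold separating the two counts: a quarter of the mean
    \<open>p * s\<close> of \<open>card (S \<inter> L u)\<close>, and twice the mean number of lists
    of \<open>Q\<close> inside \<open>S\<close>, since both equal
    \<open>s^2 / (32 * q)\<close>.\<close>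
  define t where "t = p * real s / 4"
  define w where "w S = p ^ card S * (1 - p) ^ card (V - S)" for S
  \<comment> \<open>All summands are nonnegative, so \<open>F S < 1\<close> bounds each of them by
    1: fewer than \<open>t\<close> lists of \<open>Q\<close> lie in \<open>S\<close>, and
    \<open>2 ^ card (S \<inter> L u)\<close> exceeds \<open>exp t\<close> for every \<open>u\<close>
    in \<open>A\<close>. A single expectation thus replaces a union bound.\<close>
  define F where "F S = real (card {v\<in>Q. L v \<subseteq> S}) / t
    + (\<Sum>u\<in>A. exp t * (1 / 2) ^ card (S \<inter> L u))" for S
  have a: "1 \<le> a" using A(1,2) by (simp add: a_def Suc_le_eq card_gt_0_iff)
  have q: "0 < q" using Q(1,2) by (simp add: q_def card_gt_0_iff)
  have p: "0 \<le> p" "p \<le> 1" using s_le q by (auto simp: p_def q_def field_simps)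
  have t_ge: "1 + ln a \<le> t"
    using s_ge q by (simp add: t_def p_def a_def q_def field_simps power2_eq_square)
  with a have t: "0 < t" using ln_ge_zero[of a] by linarith
  then have s_pos: "0 < s" by (cases "s = 0") (auto simp: t_def)
  have V: "finite V" using A Q by (auto simp: V_def)
  have sub: "L v \<subseteq> V" if "v \<in> A \<union> Q" for v using that by (auto simp: V_def)
  have w_sum: "sum w (Pow V) = 1"
    using sum_Pow_bernoulli_power_card_Int[OF V order_refl, of p 1] by (simp add: w_def)
  have pairs: "(\<Sum>S\<in>Pow V. w S * (real (card {v\<in>Q. L v \<subseteq> S}) / t)) = 1 / 2"
  proof -
    have card_eq: "real (card {v\<in>Q. L v \<subseteq> S}) = (\<Sum>v\<in>Q. of_bool (L v \<subseteq> S))" for S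
      using Q(1) by (simp add: of_bool_def Int_def flip: sum.inter_filter)
    have "(\<Sum>S\<in>Pow V. w S * (real (card {v\<in>Q. L v \<subseteq> S}) / t))
        = (\<Sum>S\<in>Pow V. \<Sum>v\<in>Q. w S * of_bool (L v \<subseteq> S)) / t"
      unfolding card_eq by (simp add: sum_distrib_left sum_divide_distrib)
    also have "\<dots> = (\<Sum>v\<in>Q. \<Sum>S\<in>Pow V. w S * of_bool (L v \<subseteq> S)) / t"
      by (subst sum.swap) (rule refl)
    also have "\<dots> = (\<Sum>v\<in>Q. p\<^sup>2) / t"
    proof -
      have "(\<Sum>S\<in>Pow V. w S * of_bool (L v \<subseteq> S)) = p\<^sup>2" if "v \<in> Q" for v
        using sum_Pow_bernoulli_superset[OF V sub, of v p] Q(3) that by (simp add: w_def)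
      then show ?thesis by simp
    qed
    also have "\<dots> = q * p\<^sup>2 / t" by (simp add: q_def)
    also have "\<dots> = 1 / 2"
      using s_pos q by (simp add: t_def p_def field_simps power2_eq_square)
    finally show ?thesis .
  qed
  have moment: "(\<Sum>S\<in>Pow V. w S * (exp t * (1 / 2) ^ card (S \<inter> L u))) \<le> exp (- t)"
    if u: "u \<in> A" for u
  proof -
    have "(\<Sum>S\<in>Pow V. w S * (exp t * (1 / 2) ^ card (S \<inter> L u)))
        = exp t * (\<Sum>S\<in>Pow V. w S * (1 / 2) ^ card (S \<inter> L u))"
      by (simp add: sum_distrib_left mult_ac)
    also have "\<dots> = exp t * (1 - p / 2) ^ s"
      using sum_Pow_bernoulli_power_card_Int[OF V sub, of u p "1 / 2"] A(3)[OF u] u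
      by (simp add: w_def)
    \<comment> \<open>Here \<open>p \<le> 1\<close> keeps the base \<open>1 - p / 2\<close>
      nonnegative. The power on the right is \<open>exp (- 2 * t)\<close>.\<close>
    also have "\<dots> \<le> exp t * exp (- p / 2) ^ s"
      using p exp_ge_add_one_self[of "- p / 2"] by (intro mult_left_mono power_mono) auto
    also have "\<dots> = exp (- t)"
      by (simp add: t_def mult_ac flip: exp_add exp_of_nat_mult)
    finally show ?thesis .
  qed
  have "(\<Sum>S\<in>Pow V. w S * F S)
      = 1 / 2 + (\<Sum>u\<in>A. \<Sum>S\<in>Pow V. w S * (exp t * (1 / 2) ^ card (S \<inter> L u)))"
    unfolding F_def ring_distribs sum.distrib pairs sum_distrib_left by (subst sum.swap) simp
  also have "\<dots> \<le> 1 / 2 + (\<Sum>u\<in>A. exp (- t))"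
    using moment by (intro add_left_mono sum_mono)
  also have "\<dots> = 1 / 2 + a * exp (- t)" by (simp add: a_def)
  also have "a * exp (- t) \<le> a * exp (- (1 + ln a))"
    using t_ge a by (intro mult_left_mono) auto
  also have "\<dots> = 1 / exp 1"
    using a by (simp add: exp_diff exp_minus field_simps)
  also have "\<dots> < (1 / 2 :: real)"
    using ln_2_less_1 ln_less_cancel_iff[of 2 "exp 1"] by (simp add: field_simps)
  finally have "(\<Sum>S\<in>Pow V. w S * F S) < 1" by simp
  then obtain S where S: "F S < 1"
    using exists_less_1_of_weighted_sum_less_1[OF _ w_sum, of F] p by (auto simp: w_def)
  have "card {v\<in>Q. L v \<subseteq> S} < card (S \<inter> L u)" if u: "u \<in> A" for u
  proof -
    have nonneg: "0 \<le> (\<Sum>u\<in>A. exp t * (1 / 2) ^ card (S \<inter> L u))"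
      by (intro sum_nonneg) simp
    then have "real (card {v\<in>Q. L v \<subseteq> S}) / t < 1" using S by (simp add: F_def)
    then have few: "real (card {v\<in>Q. L v \<subseteq> S}) < t" using t by simp
    have "exp t * (1 / 2) ^ card (S \<inter> L u) \<le> (\<Sum>u\<in>A. exp t * (1 / 2) ^ card (S \<inter> L u))"
      using A(1) u by (intro member_le_sum) auto
    also have "\<dots> < 1" using S t divide_nonneg_pos[OF of_nat_0_le_iff t, of "card {v\<in>Q. L v \<subseteq> S}"]
      unfolding F_def by linarith
    finally have "exp t < 2 ^ card (S \<inter> L u)" by (simp add: field_simps)
    \<comment> \<open>The crude bound \<open>2 \<le> exp 1\<close> suffices to compare the
      exponents.\<close>
    also have "\<dots> \<le> exp 1 ^ card (S \<inter> L u)"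
      using exp_ge_add_one_self[of 1] by (intro power_mono) auto
    also have "\<dots> = exp (real (card (S \<inter> L u)))"
      by (simp flip: exp_of_nat_mult)
    finally have "t < real (card (S \<inter> L u))" by simp
    with few show ?thesis by linarith
  qed
  then show ?thesis by blast
qed

text \<open>Delete from \<open>S\<close> one colour of each list of \<open>Q\<close> contained in
  it. Fewer colours are lost than any list of \<open>A\<close> has in \<open>S\<close>, so
  \<open>A\<close> can be coloured from the remaining set \<open>I\<close>. Each list of
  \<open>Q\<close> has a colour outside \<open>I\<close>: its deleted one, or one that was never in
  \<open>S\<close>.\<close>

lemma bipartite_list_coloring:
  fixes L :: "'v \<Rightarrow> 'c set"
  assumes disj: "A \<inter> Q = {}" and Q: "finite Q" "\<And>v. v \<in> Q \<Longrightarrow> L v \<noteq> {}"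
    and S: "\<And>u. u \<in> A \<Longrightarrow> card {v\<in>Q. L v \<subseteq> S} < card (S \<inter> L u)"
  shows "\<exists>c. (\<forall>v\<in>A \<union> Q. c v \<in> L v) \<and> (\<forall>u\<in>A. \<forall>v\<in>Q. c u \<noteq> c v)"
proof -
  define B where "B = {v\<in>Q. L v \<subseteq> S}"
  define r where "r v = (SOME y. y \<in> L v)" for v
  have r: "r v \<in> L v" if "v \<in> Q" for v
    using Q(2)[OF that] by (simp add: r_def some_in_eq)
  define I where "I = S - r ` B"
  have B: "finite B" using Q(1) by (simp add: B_def)
  have "\<exists>x. x \<in> L u \<and> x \<in> I" if "u \<in> A" for u
  proof -
    have "card (r ` B) < card (S \<inter> L u)"
      using S[OF that] card_image_le[OF B, of r] by (simp add: B_def)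
    then have "\<not> S \<inter> L u \<subseteq> r ` B" using B by (meson card_mono finite_imageI not_le)
    then show ?thesis by (auto simp: I_def)
  qed
  then obtain cA where cA: "\<And>u. u \<in> A \<Longrightarrow> cA u \<in> L u \<and> cA u \<in> I" by metis
  have "\<exists>x. x \<in> L v \<and> x \<notin> I" if "v \<in> Q" for v
    using r[OF that] that by (cases "L v \<subseteq> S") (auto simp: I_def B_def)
  then obtain cQ where cQ: "\<And>v. v \<in> Q \<Longrightarrow> cQ v \<in> L v \<and> cQ v \<notin> I" by metis
  have "cA u \<noteq> cQ v" if "u \<in> A" "v \<in> Q" for u v
    using cA[OF that(1)] cQ[OF that(2)] by metis
  then show ?thesis
    using cA cQ disj by (intro exI[of _ "\<lambda>v. if v \<in> A then cA v else cQ v"]) auto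
qed

theorem theorem3p1:
  fixes G :: "('a, 'b) pre_digraph" and a q :: nat
  assumes "complete_bipartite_digraph a q G" and "2 \<le> a" and "a \<le> q"
  shows "int (sum_choice_number G)
    \<le> 2 * int q + int a * \<lceil>sqrt (32 * real q * (1 + ln (real a)))\<rceil>"
proof -
  define x where "x = 32 * real q * (1 + ln (real a))"
  define s where "s = nat \<lceil>sqrt x\<rceil>"
  obtain A Q where G: "verts G = A \<union> Q" "A \<inter> Q = {}" "card A = a" "card Q = q"
      "arcs_ends G = A \<times> Q \<union> Q \<times> A"
    using assms(1) unfolding complete_bipartite_digraph_def by blast
  have fin: "finite A" "finite Q" "A \<noteq> {}" "Q \<noteq> {}"
    using G(3,4) assms(2,3) by (auto intro!: card_ge_0_finite)
  have x: "0 \<le> x" using assms(2) by (simp add: x_def)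
  have "sqrt x \<le> real s" using x by (simp add: s_def real_nat_ceiling_ge)
  then have s_ge: "x \<le> (real s)\<^sup>2" using x by (simp add: sqrt_le_D)
  \<comment> \<open>This leads to \<open>s \<le> 8 * q\<close>, which makes the selection
    probability at most 1. As \<open>32 \<le> 36\<close>, the root is at most the integer
    \<open>6 * q\<close>, so rounding up does no harm.\<close>
  have "ln (real a) \<le> real q - 1"
    using ln_le_minus_one[of "real a"] assms(2,3) by linarith
  then have "x \<le> 32 * real q * real q"
    unfolding x_def by (intro mult_left_mono) auto
  also have "\<dots> \<le> (6 * real q)\<^sup>2" by (simp add: power2_eq_square)
  finally have "sqrt x \<le> 6 * real q" by (intro real_le_lsqrt) auto
  then have s_le: "s \<le> 8 * q" by (simp add: s_def ceiling_le_iff)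
  define f where "f v = (if v \<in> A then s else 2)" for v
  have "choosable G f"
    unfolding choosable_def
  proof (intro allI impI)
    fix L :: "'a \<Rightarrow> nat set"
    assume "list_assignment G f L"
    then have LA: "\<And>u. u \<in> A \<Longrightarrow> finite (L u) \<and> card (L u) = s"
      and LQ: "\<And>v. v \<in> Q \<Longrightarrow> finite (L v) \<and> card (L v) = 2"
      using G(1,2) by (auto simp: list_assignment_def f_def)
    obtain S where S: "\<forall>u\<in>A. card {v\<in>Q. L v \<subseteq> S} < card (S \<inter> L u)"
      using exists_set_few_pairs_large_intersections[of A L s Q] fin LA LQ s_le s_ge G(3,4)
      by (auto simp: x_def)
    have "L v \<noteq> {}" if "v \<in> Q" for v using LQ[OF that] by auto
    then obtain c where c: "\<forall>v\<in>A \<union> Q. c v \<in> L v" "\<forall>u\<in>A. \<forall>v\<in>Q. c u \<noteq> c v"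
      using bipartite_list_coloring[OF G(2) fin(2), of L S] S by blast
    then have "proper_coloring G c" by (force simp: proper_coloring_def G(5))
    with c(1) show "\<exists>c. proper_coloring G c \<and> (\<forall>v\<in>verts G. c v \<in> L v)"
      by (auto simp: G(1))
  qed
  then have "sum_choice_number G \<le> (\<Sum>v\<in>verts G. f v)" by (rule sum_choice_number_le)
  also have "\<dots> = (\<Sum>v\<in>A. f v) + (\<Sum>v\<in>Q. f v)"
    unfolding G(1) using fin G(2) by (intro sum.union_disjoint) auto
  also have "(\<Sum>v\<in>A. f v) = a * s" by (simp add: f_def G(3))
  also have "(\<Sum>v\<in>Q. f v) = (\<Sum>v\<in>Q. 2)"
    using G(2) by (intro sum.cong) (auto simp: f_def)
  finally have "sum_choice_number G \<le> a * s + 2 * q" by (simp add: G(4) mult.commute)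
  then have "int (sum_choice_number G) \<le> int (a * s + 2 * q)" by (simp only: of_nat_le_iff)
  also have "int (a * s + 2 * q) = 2 * int q + int a * int s" by simp
  \<comment> \<open>The ceiling is nonnegative, so \<open>nat\<close> did not truncate it.\<close>
  also have "int s = \<lceil>sqrt x\<rceil>"
    using x by (simp add: s_def) (smt (verit) real_sqrt_ge_zero zero_le_ceiling)
  finally show ?thesis by (simp add: x_def)
qed

end
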